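(* Let $(X,d,\mathfrak{m})$ be a complete, separable metric measure space with $\int_Xe^{-cd(x,y)^2}\,\mathfrak{m}(dy)<\infty$ for some (hence all) $x\in X$ and all $c>0$. Assume that $\mathfrak{m}\in\mathcal{P}^2(X)$ and that $(X,d,\mathfrak{m})$ satisfies $\mathrm{CD}^e(K,N)$ with $K>0$ and $N<0$. Then, for any $\mu\in\mathcal{P}^2(X)$, we have $$\mathrm{Ent}_{\mathfrak{m}}(\mu)\ge-N\log\left[\cosh\left(\sqrt{-\frac{K}{N}}\,W_2(\mathfrak{m},\mu)\right)\right].$$
   Context: For $\kappa\le0$ and $\theta\ge0$: $\mathfrak{s}_0(\theta)=\theta$ and $\mathfrak{s}_\kappa(\theta)=\frac{1}{\sqrt{-\kappa}}\sinh(\sqrt{-\kappa}\theta)$ if $\kappa<0$. For $t\in[0,1]$, $\sigma^{(t)}_\kappa(\theta)=\mathfrak{s}_\kappa(t\theta)/\mathfrak{s}_\kappa(\theta)$ for $\theta>0$, and $\sigma^{(t)}_\kappa(0)=t$. $\mathcal{P}^2(X)$ is the set of Borel probability measures on $X$ with finite second moment, equipped with the $L^2$-Wasserstein distance $W_2$. The relative entropy is $\mathrm{Ent}_{\mathfrak{m}}(\mu)=\int_X\rho\log\rho\,d\mathfrak{m}$ if $\mu=\rho\mathfrak{m}\ll\mathfrak{m}$ and $\int_{\{\rho>1\}}\rho\log\rho\,d\mathfrak{m}<\infty$, and $\mathrm{Ent}_{\mathfrak{m}}(\mu)=\infty$ otherwise. $(K,N)$-convexity for $K>0$, $N<0$: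 on a metric space $(Y,\delta)$, a function $f:Y\to(-\infty,\infty]$ with $f_N:=e^{-f/N}$ is $(K,N)$-convex if any $y_0,y_1$ with $f(y_0),f(y_1)<\infty$ admit a minimal geodesic $\gamma:[0,1]\to Y$ (i.e. $\delta(\gamma(s),\gamma(t))=|s-t|\delta(\gamma(0),\gamma(1))$) from $y_0$ to $y_1$ with $f_N(\gamma(t))\le\sigma^{(1-t)}_{K/N}(D)f_N(y_0)+\sigma^{(t)}_{K/N}(D)f_N(y_1)$ for all $t\in[0,1]$, where $D=\delta(y_0,y_1)$. The space $(X,d,\mathfrak{m})$ satisfies $\mathrm{CD}^e(K,N)$ if $\mathrm{Ent}_{\mathfrak{m}}$ is $(K,N)$-convex on $(\mathcal{P}^2(X),W_2)$. *)

theory Defs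
  imports "HOL-Probability.Probability"
begin

(* Intended for kappa <= 0 and theta >= 0 only. *)
definition s_fun :: "real \<Rightarrow> real \<Rightarrow> real" where
  "s_fun \<kappa> \<theta> = (if \<kappa> = 0 then \<theta> else 1 / sqrt (- \<kappa>) * sinh (sqrt (- \<kappa>) * \<theta>))"

definition distortion_coeff :: "real \<Rightarrow> real \<Rightarrow> real \<Rightarrow> real" where
  "distortion_coeff \<kappa> t \<theta> = (if \<theta> = 0 then t else s_fun \<kappa> (t * \<theta>) / s_fun \<kappa> \<theta>)"

definition P2 :: "'a::metric_space measure set" where
  "P2 = {\<mu>. prob_space \<mu> \<and> sets \<mu> = sets borel \<and>
             (\<exists>x0. (\<integral>\<^sup>+x. ennreal ((dist x0 x)\<^sup>2) \<partial>\<mu>) < \<infinity>)}"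

definition couplings :: "'a::metric_space measure \<Rightarrow> 'a measure \<Rightarrow> ('a \<times> 'a) measure set" where
  "couplings \<mu> \<nu> = {\<pi>. sets \<pi> = sets borel \<and> distr \<pi> borel fst = \<mu> \<and> distr \<pi> borel snd = \<nu>}"

(* Real-valued, hence meaningful only where the infimum is finite; this includes P2. *)
definition W2 :: "'a::metric_space measure \<Rightarrow> 'a measure \<Rightarrow> real" where
  "W2 \<mu> \<nu> = sqrt (enn2real
     (INF \<pi>\<in>couplings \<mu> \<nu>. \<integral>\<^sup>+z. ennreal ((dist (fst z) (snd z))\<^sup>2) \<partial>\<pi>))"

(* When the second case applies, the integral of rho * ln rho is positive part minus negative
   part. The former is finite because rho * ln rho > 0 exactly where rho > 1; the latter is
   allowed to be infinite, and the difference is taken in ereal. *)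
definition Ent :: "'a measure \<Rightarrow> 'a measure \<Rightarrow> ereal" where
  "Ent m \<mu> =
     (let \<rho> = (\<lambda>x. enn2real (RN_deriv m \<mu> x)) in
      if absolutely_continuous m \<mu> \<and>
         (\<integral>\<^sup>+x\<in>{x \<in> space m. \<rho> x > 1}. ennreal (\<rho> x * ln (\<rho> x)) \<partial>m) < \<infinity>
      then enn2ereal (\<integral>\<^sup>+x. ennreal (\<rho> x * ln (\<rho> x)) \<partial>m)
           - enn2ereal (\<integral>\<^sup>+x. ennreal (- (\<rho> x * ln (\<rho> x))) \<partial>m)
      else \<infinity>)"

(* The extension of exp (- r / N) to extended reals r, with the limits that are
   correct for N < 0. *)
definition exp_neg_div :: "real \<Rightarrow> ereal \<Rightarrow> ereal" where
  "exp_neg_div N y =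
     (case y of ereal r \<Rightarrow> ereal (exp (- r / N)) | PInfty \<Rightarrow> \<infinity> | MInfty \<Rightarrow> 0)"

definition minimal_geodesic ::
  "'b set \<Rightarrow> ('b \<Rightarrow> 'b \<Rightarrow> real) \<Rightarrow> (real \<Rightarrow> 'b) \<Rightarrow> 'b \<Rightarrow> 'b \<Rightarrow> bool" where
  "minimal_geodesic Y \<delta> \<gamma> y0 y1 \<longleftrightarrow>
     \<gamma> \<in> {0..1} \<rightarrow> Y \<and> \<gamma> 0 = y0 \<and> \<gamma> 1 = y1 \<and>
     (\<forall>s\<in>{0..1}. \<forall>t\<in>{0..1}. \<delta> (\<gamma> s) (\<gamma> t) = \<bar>s - t\<bar> * \<delta> (\<gamma> 0) (\<gamma> 1))"

(* Intended for K > 0 and N < 0. The first conjunct expresses that the codomain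
   of f is (-infinity, infinity]. *)
definition KN_convex ::
  "real \<Rightarrow> real \<Rightarrow> 'b set \<Rightarrow> ('b \<Rightarrow> 'b \<Rightarrow> real) \<Rightarrow> ('b \<Rightarrow> ereal) \<Rightarrow> bool" where
  "KN_convex K N Y \<delta> f \<longleftrightarrow>
     (\<forall>y\<in>Y. f y > -\<infinity>) \<and>
     (\<forall>y0\<in>Y. \<forall>y1\<in>Y. f y0 < \<infinity> \<and> f y1 < \<infinity> \<longrightarrow>
       (\<exists>\<gamma>. minimal_geodesic Y \<delta> \<gamma> y0 y1 \<and>
         (\<forall>t\<in>{0..1}. exp_neg_div N (f (\<gamma> t)) \<le>
            ereal (distortion_coeff (K / N) (1 - t) (\<delta> y0 y1)) * exp_neg_div N (f y0) +
            ereal (distortion_coeff (K / N) t (\<delta> y0 y1)) * exp_neg_div N (f y1))))"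

definition CDe :: "real \<Rightarrow> real \<Rightarrow> 'a::metric_space measure \<Rightarrow> bool" where
  "CDe K N m \<longleftrightarrow> KN_convex K N P2 W2 (Ent m)"

end

theory Submission
  imports Defs
begin

text \<open>
  Relative to a probability measure \<open>m\<close>, the entropy of a probability measure is nonnegative
  (Jensen, or the elementary inequality \<open>\<rho> ln \<rho> \<ge> \<rho> - 1\<close>), and it vanishes at \<open>m\<close>. So \<open>m\<close>
  minimises the entropy, and the bound to be shown is the growth that \<open>(K,N)\<close>-convexity forces
  on any function away from a point where it attains its minimum \<open>0\<close>.

  This growth estimate has nothing to do with measures. Put \<open>\<theta> = sqrt (- K / N) * D\<close>, where \<open>D\<close>
  is the distance from the minimum point to a point \<open>y\<close>, and \<open>F = exp (- f y / N)\<close>. Since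
  \<open>N < 0\<close> and \<open>f \<ge> 0\<close>, the transformed function is at least \<open>1\<close> along the geodesic, and equal
  to \<open>1\<close> at its start, so convexity gives
  \<open>sinh \<theta> \<le> sinh ((1 - t) * \<theta>) + sinh (t * \<theta>) * F\<close> for all \<open>t\<close>. There is equality at \<open>t = 0\<close>,
  hence the right-hand side has a nonnegative derivative there, which says \<open>F \<ge> cosh \<theta>\<close>.
  Taking logarithms gives the bound.
\<close>

text \<open>
  Both sides of the hypothesis agree at \<open>t = 0\<close>, where the right-hand side has the derivative
  \<open>\<theta> * (F - cosh \<theta>)\<close>; the conclusion says that this derivative is not negative.
\<close>

lemma cosh_le_if_sinh_interpolation:
  fixes \<theta> F :: real
  assumes "\<theta> > 0"
    and interp: "\<And>t. 0 < t \<Longrightarrow> t < 1 \<Longrightarrow> sinh \<theta> \<le> sinh ((1 - t) * \<theta>) + sinh (t * \<theta>) * F"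
  shows "cosh \<theta> \<le> F"
proof (rule ccontr)
  assume "\<not> cosh \<theta> \<le> F"
  define \<phi> where "\<phi> = (\<lambda>t. sinh ((1 - t) * \<theta>) + sinh (t * \<theta>) * F)"
  have deriv: "(\<phi> has_real_derivative \<theta> * (F - cosh \<theta>)) (at 0)"
    unfolding \<phi>_def by (auto intro!: derivative_eq_intros simp: algebra_simps)
  have "\<theta> * (F - cosh \<theta>) < 0"
    using \<open>\<theta> > 0\<close> \<open>\<not> cosh \<theta> \<le> F\<close> by (simp add: mult_pos_neg)
  from DERIV_neg_dec_right[OF deriv this]
  obtain d where d: "d > 0" "\<And>h. 0 < h \<Longrightarrow> h < d \<Longrightarrow> \<phi> h < \<phi> 0"
    by auto
  define t where "t = min d 1 / 2"
  have t: "0 < t" "t < d" "t < 1"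
    using d(1) by (auto simp: t_def)
  have "\<phi> t < sinh \<theta>"
    using d(2)[OF t(1,2)] by (simp add: \<phi>_def)
  with interp[OF t(1,3)] show False
    by (simp add: \<phi>_def)
qed

lemma distortion_coeff_neg:
  assumes "\<kappa> < 0" and "D \<noteq> 0"
  shows "distortion_coeff \<kappa> t D = sinh (t * (sqrt (- \<kappa>) * D)) / sinh (sqrt (- \<kappa>) * D)"
  using assms by (simp add: distortion_coeff_def s_fun_def mult_ac)

lemma exp_neg_div_ge_1:
  assumes "N < 0" and "y \<ge> 0"
  shows "exp_neg_div N y \<ge> 1"
  using assms
  by (cases y) (auto simp: exp_neg_div_def one_ereal_def divide_nonneg_neg)

text \<open>
  Along the geodesic from a zero \<open>y0\<close> of \<open>f\<close> the transform of \<open>f\<close> starts at its least possible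
  value \<open>1\<close> and never drops below it, so the convexity bound at time \<open>t\<close> is at least \<open>1\<close> as well.
  Multiplied by \<open>sinh \<theta>\<close>, this is the interpolation inequality in \<open>cosh_le_if_sinh_interpolation\<close>. For
  \<open>\<delta> y0 y = 0\<close> the claim is just \<open>f y \<ge> 0\<close>.
\<close>

lemma KN_convex_growth_from_zero_minimum:
  assumes "K > 0" and "N < 0"
    and convex: "KN_convex K N Y \<delta> f"
    and nonneg: "\<And>z. z \<in> Y \<Longrightarrow> f z \<ge> 0"
    and "y0 \<in> Y" and "f y0 = 0" and "y \<in> Y" and "\<delta> y0 y \<ge> 0"
  shows "f y \<ge> ereal (- N * ln (cosh (sqrt (- (K / N)) * \<delta> y0 y)))"
proof -
  define D where "D = \<delta> y0 y"
  define \<theta> where "\<theta> = sqrt (- (K / N)) * D"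
  have \<kappa>: "K / N < 0"
    using assms by (simp add: divide_pos_neg)
  consider "D = 0" | "f y = \<infinity>" | r where "D > 0" "f y = ereal r"
    using nonneg[OF \<open>y \<in> Y\<close>] \<open>\<delta> y0 y \<ge> 0\<close> by (cases "f y") (auto simp: D_def less_le)
  then have "f y \<ge> ereal (- N * ln (cosh \<theta>))"
  proof cases
    case 1
    then show ?thesis
      using nonneg[OF \<open>y \<in> Y\<close>] by (simp add: \<theta>_def flip: zero_ereal_def)
  next
    case 2
    then show ?thesis by simp
  next
    case 3
    define F where "F = exp (- r / N)"
    have "\<theta> > 0"
      using 3 \<kappa> unfolding \<theta>_def by (intro mult_pos_pos) auto
    obtain \<gamma> where geo: "minimal_geodesic Y \<delta> \<gamma> y0 y"
      and bound: "\<And>t. t \<in> {0..1} \<Longrightarrow> exp_neg_div N (f (\<gamma> t)) \<le>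
            ereal (distortion_coeff (K / N) (1 - t) D) * exp_neg_div N (f y0) +
            ereal (distortion_coeff (K / N) t D) * exp_neg_div N (f y)"
      using convex \<open>y0 \<in> Y\<close> \<open>y \<in> Y\<close> \<open>f y0 = 0\<close> 3 unfolding KN_convex_def D_def by force
    have "cosh \<theta> \<le> F"
    proof (rule cosh_le_if_sinh_interpolation[OF \<open>\<theta> > 0\<close>])
      fix t :: real
      assume t: "0 < t" "t < 1"
      have "\<gamma> t \<in> Y"
        using geo t by (auto simp: minimal_geodesic_def)
      have "1 \<le> exp_neg_div N (f (\<gamma> t))"
        using exp_neg_div_ge_1[OF \<open>N < 0\<close> nonneg[OF \<open>\<gamma> t \<in> Y\<close>]] .
      also have "\<dots> \<le> ereal (distortion_coeff (K / N) (1 - t) D + distortion_coeff (K / N) t D * F)"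
        using bound[of t] t \<open>f y0 = 0\<close> 3
        by (simp add: exp_neg_div_def F_def zero_ereal_def)
      finally have "1 \<le> sinh ((1 - t) * \<theta>) / sinh \<theta> + sinh (t * \<theta>) / sinh \<theta> * F"
        using 3 by (simp add: distortion_coeff_neg[OF \<kappa>] \<theta>_def one_ereal_def)
      then show "sinh \<theta> \<le> sinh ((1 - t) * \<theta>) + sinh (t * \<theta>) * F"
        using \<open>\<theta> > 0\<close> by (simp add: field_simps)
    qed
    then have "ln (cosh \<theta>) \<le> - r / N"
      using ln_mono[of "cosh \<theta>" F] by (simp add: F_def cosh_real_pos)
    then show ?thesis
      using 3 \<open>N < 0\<close> by (simp add: field_simps)
  qed
  then show ?thesis
    by (simp add: \<theta>_def D_def)
qed

text \<open>
  Integrate \<open>\<rho> ln \<rho> \<ge> \<rho> - 1\<close>, where \<open>\<rho>\<close> and \<open>1\<close> both have integral \<open>1\<close>. To stay clear of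
  integrability questions for the possibly infinite negative part, the inequality is first
  rearranged so that both sides are sums of nonnegative functions.
\<close>

lemma Ent_nonneg:
  assumes "prob_space m" and "prob_space \<mu>" and "sets \<mu> = sets m"
  shows "Ent m \<mu> \<ge> 0"
proof (cases "absolutely_continuous m \<mu>")
  case False
  then show ?thesis by (simp add: Ent_def)
next
  case True
  interpret m: prob_space m by fact
  interpret \<mu>: prob_space \<mu> by fact
  define \<rho> where "\<rho> = (\<lambda>x. enn2real (RN_deriv m \<mu> x))"
  have [measurable]: "\<rho> \<in> borel_measurable m"
    by (simp add: \<rho>_def)
  have "AE x in m. RN_deriv m \<mu> x \<noteq> \<infinity>"
    using m.RN_deriv_finite[OF \<mu>.sigma_finite_measure True \<open>sets \<mu> = sets m\<close>] .
  then have "(\<integral>\<^sup>+x. ennreal (\<rho> x) \<partial>m) = (\<integral>\<^sup>+x. RN_deriv m \<mu> x \<partial>m)"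
    by (intro nn_integral_cong_AE) (auto simp: \<rho>_def less_top)
  also have "\<dots> = emeasure (density m (RN_deriv m \<mu>)) (space m)"
    by (simp add: emeasure_density cong: nn_integral_cong)
  also have "\<dots> = emeasure \<mu> (space \<mu>)"
    using m.density_RN_deriv[OF True \<open>sets \<mu> = sets m\<close>] sets_eq_imp_space_eq[OF \<open>sets \<mu> = sets m\<close>]
    by simp
  finally have int_\<rho>: "(\<integral>\<^sup>+x. ennreal (\<rho> x) \<partial>m) = 1"
    by (simp add: \<mu>.emeasure_space_1)
  define P where "P = (\<integral>\<^sup>+x. ennreal (\<rho> x * ln (\<rho> x)) \<partial>m)"
  define M where "M = (\<integral>\<^sup>+x. ennreal (- (\<rho> x * ln (\<rho> x))) \<partial>m)"
  have pointwise: "ennreal (- (r * ln r)) + ennreal r \<le> ennreal (r * ln r) + 1"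
    if "r \<ge> 0" for r :: real
  proof -
    have "r - 1 \<le> r * ln r"
    proof (cases "r = 0")
      case False
      \<comment> \<open>This is \<open>ln s \<le> s - 1\<close> at \<open>s = 1 / r\<close>, multiplied by \<open>r\<close>.\<close>
      with that have "- ln r \<le> 1 / r - 1"
        using ln_le_minus_one[of "1 / r"] by (simp add: ln_div)
      with that False show ?thesis by (simp add: field_simps)
    qed simp
    then have "max 0 (- (r * ln r)) + r \<le> max 0 (r * ln r) + 1"
      by linarith
    then have "ennreal (max 0 (- (r * ln r)) + r) \<le> ennreal (max 0 (r * ln r) + 1)"
      by (rule ennreal_leI)
    then show ?thesis
      using that by (simp add: ennreal_plus del: ennreal_le_iff2)
  qed
  have "M + 1 = (\<integral>\<^sup>+x. ennreal (- (\<rho> x * ln (\<rho> x))) + ennreal (\<rho> x) \<partial>m)"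
    by (simp add: M_def int_\<rho> nn_integral_add)
  also have "\<dots> \<le> (\<integral>\<^sup>+x. ennreal (\<rho> x * ln (\<rho> x)) + 1 \<partial>m)"
    by (intro nn_integral_mono pointwise) (simp add: \<rho>_def)
  also have "\<dots> = P + 1"
    by (simp add: P_def nn_integral_add m.emeasure_space_1)
  finally have "M \<le> P"
    by (simp add: add.commute)
  then have "0 \<le> enn2ereal P - enn2ereal M"
    by (cases P; cases M) (auto simp: less_eq_ennreal.rep_eq)
  then show ?thesis
    by (simp add: Ent_def Let_def flip: \<rho>_def P_def M_def)
qed

lemma Ent_self:
  assumes "sigma_finite_measure m"
  shows "Ent m m = 0"
proof -
  interpret sigma_finite_measure m by fact
  have "density m (\<lambda>_. 1) = m"
    by (rule density_1)
  then have "AE x in m. 1 = RN_deriv m m x"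
    by (intro RN_deriv_unique) auto
  then have "AE x in m. enn2real (RN_deriv m m x) = 1"
    by eventually_elim (metis enn2real_1)
  then have "AE x in m. enn2real (RN_deriv m m x) * ln (enn2real (RN_deriv m m x)) = 0"
    by eventually_elim simp
  then have zero: "(\<integral>\<^sup>+x. h x (enn2real (RN_deriv m m x) * ln (enn2real (RN_deriv m m x))) \<partial>m) = 0"
    if "\<And>x. h x 0 = 0" for h :: "'a \<Rightarrow> real \<Rightarrow> ennreal"
    using that by (subst nn_integral_cong_AE[where v = "\<lambda>_. 0"]) auto
  have "absolutely_continuous m m"
    by (simp add: absolutely_continuous_def)
  then show ?thesis
    using zero[of "\<lambda>x r. ennreal r * indicator {x \<in> space m. enn2real (RN_deriv m m x) > 1} x"]
      zero[of "\<lambda>_ r. ennreal r"] zero[of "\<lambda>_ r. ennreal (- r)"]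
    by (simp add: Ent_def Let_def)
qed

theorem corollary4p18:
  fixes m \<mu> :: "'a::polish_space measure" and K N :: real
  assumes "sets m = sets borel"
    and "\<exists>x. \<forall>c>0. (\<integral>\<^sup>+y. ennreal (exp (- c * (dist x y)\<^sup>2)) \<partial>m) < \<infinity>"
    and "m \<in> P2"
    and "K > 0" and "N < 0"
    and "CDe K N m"
    and "\<mu> \<in> P2"
  shows "Ent m \<mu> \<ge> ereal (- N * ln (cosh (sqrt (- (K / N)) * W2 m \<mu>)))"
proof (rule KN_convex_growth_from_zero_minimum[where Y = P2])
  have prob: "prob_space m"
    using \<open>m \<in> P2\<close> by (simp add: P2_def)
  show "KN_convex K N P2 W2 (Ent m)"
    using \<open>CDe K N m\<close> by (simp add: CDe_def)
  show "Ent m \<nu> \<ge> 0" if "\<nu> \<in> P2" for \<nu>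
    using that \<open>sets m = sets borel\<close> by (intro Ent_nonneg prob) (auto simp: P2_def)
  show "Ent m m = 0"
    by (rule Ent_self) (rule prob_space_imp_sigma_finite[OF prob])
  show "W2 m \<mu> \<ge> 0"
    by (simp add: W2_def)
qed (use assms in auto)

end
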